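(* Let $X=\{F=0\}\subset\mathbb P^2$ be a non-singular plane quartic over $\mathbb C$, with homogeneous coordinates $(x:y:z)$ chosen so that $X\cdot\{z=0\}=4\infty$, where $\infty=(0:1:0)$. Let $Z$ be the affine variety of quadruples of conics $(A,B,G,H)$ with $F=AG+BH$, where, in affine coordinates ($z=1$), $A=a_{00}+a_{10}x+a_{01}y-x^2$, $B=b_{00}+b_{10}x+b_{01}y-xy$, and the coefficient of $xy$ in $G$ equals $1$. Let $V=H^0(\mathbb P^2,\mathcal O_{\mathbb P^2}(2)\otimes\mathfrak m_\infty)$ be the space of conics passing through $\infty$. Then the morphism $$Z\longrightarrow \mathbb G(1,\mathbb PV),\qquad (A,B,G,H)\longmapsto \{\lambda A+\mu B\}$$ is injective, and is in fact an embedding.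
   Context: The ground field is $\mathbb C$. $\mathbb G(1,\mathbb PV)$ is the Grassmannian of lines in $\mathbb PV$, and $\{\lambda A+\mu B\}$ denotes the line in $\mathbb PV$ (pencil of conics) spanned by $A$ and $B$. $\mathfrak m_\infty$ is the ideal sheaf of the point $\infty$. $Z$ is regarded as a closed subvariety of $\mathbb A^{17}$ whose coordinates are the free coefficients of $A$ (3), $B$ (3), $G$ (5) and $H$ (6), with equations obtained by comparing coefficients in $F=AG+BH$. *)

theory Defs
  imports
    "HOL-Analysis.Analysis"
    "HOL-Library.Poly_Mapping"
    "HOL-Computational_Algebra.Polynomial"
begin

section \<open>Complex polynomials in variables indexed by a type\<close>

type_synonym 'v mpol = "('v \<Rightarrow>\<^sub>0 nat) \<Rightarrow>\<^sub>0 complex"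

definition const :: "complex \<Rightarrow> 'v mpol" where
  "const c = Poly_Mapping.single 0 c"

definition var :: "'v \<Rightarrow> 'v mpol" where
  "var i = Poly_Mapping.single (Poly_Mapping.single i 1) 1"

definition eval_via :: "(complex \<Rightarrow> 'r::comm_ring_1) \<Rightarrow> ('v \<Rightarrow> 'r) \<Rightarrow> 'v mpol \<Rightarrow> 'r" where
  "eval_via \<phi> v p = (\<Sum>m\<in>Poly_Mapping.keys p. \<phi> (Poly_Mapping.lookup p m) *
      (\<Prod>i\<in>Poly_Mapping.keys m. v i ^ Poly_Mapping.lookup m i))"

definition eval :: "'v mpol \<Rightarrow> ('v \<Rightarrow> complex) \<Rightarrow> complex" where
  "eval p v = eval_via (\<lambda>c. c) v p"

definition homogeneous :: "nat \<Rightarrow> 'v mpol \<Rightarrow> bool" where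
  "homogeneous d p \<longleftrightarrow> (\<forall>m\<in>Poly_Mapping.keys p.
      (\<Sum>i\<in>Poly_Mapping.keys m. Poly_Mapping.lookup m i) = d)"

text \<open>Formal partial derivative; the truncated subtraction in the exponent is harmless,
  since the coefficient vanishes when the exponent of the variable is 0.\<close>

definition pd :: "'v \<Rightarrow> 'v mpol \<Rightarrow> 'v mpol" where
  "pd i p = (\<Sum>m\<in>Poly_Mapping.keys p. Poly_Mapping.single (m - Poly_Mapping.single i 1)
      (of_nat (Poly_Mapping.lookup m i) * Poly_Mapping.lookup p m))"

section \<open>Spaces with functions\<close>

text \<open>Varieties over the complex numbers are treated as topological spaces with a notion of
  regular complex-valued function on each open set. Only the values of \<open>f\<close> on \<open>U\<close> matter in
  \<open>regular X U f\<close>.\<close>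

record 'a fspace =
  zariski :: "'a topology"
  regular :: "'a set \<Rightarrow> ('a \<Rightarrow> complex) \<Rightarrow> bool"

abbreviation points :: "'a fspace \<Rightarrow> 'a set" where
  "points X \<equiv> topspace (zariski X)"

text \<open>The set \<open>S\<close> with the topology generated by the nonvanishing loci of the denominators of a
  family \<open>R\<close> of fractions, a function being regular if it is locally a fraction in \<open>R\<close>.\<close>

definition fraction_space :: "'a set \<Rightarrow> (('a \<Rightarrow> complex) \<times> ('a \<Rightarrow> complex)) set \<Rightarrow> 'a fspace" where
  "fraction_space S R =
    (let T = topology_generated_by {{s \<in> S. q s \<noteq> 0} | p q. (p, q) \<in> R} in
     \<lparr>zariski = T,
      regular = (\<lambda>U f. \<forall>u\<in>U. \<exists>W p q. openin T W \<and> u \<in> W \<and> W \<subseteq> U \<and> (p, q) \<in> R \<and>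
                   (\<forall>w\<in>W. q w \<noteq> 0 \<and> f w = p w / q w))\<rparr>)"

definition affine_variety :: "('v \<Rightarrow> complex) set \<Rightarrow> ('v \<Rightarrow> complex) fspace" where
  "affine_variety S = fraction_space S {(eval p, eval q) | p q. True}"

text \<open>Here \<open>h\<close> assigns to each point of \<open>S\<close> a vector of homogeneous coordinates.\<close>

definition projective_variety :: "('a \<Rightarrow> 'v \<Rightarrow> complex) \<Rightarrow> 'a set \<Rightarrow> 'a fspace" where
  "projective_variety h S = fraction_space S
     {(\<lambda>s. eval p (h s), \<lambda>s. eval q (h s)) | p q. \<exists>d. homogeneous d p \<and> homogeneous d q}"

definition morphism :: "'a fspace \<Rightarrow> 'b fspace \<Rightarrow> ('a \<Rightarrow> 'b) \<Rightarrow> bool" where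
  "morphism X Y \<phi> \<longleftrightarrow> continuous_map (zariski X) (zariski Y) \<phi> \<and>
     (\<forall>V f. openin (zariski Y) V \<longrightarrow> regular Y V f \<longrightarrow>
        regular X {x \<in> points X. \<phi> x \<in> V} (f \<circ> \<phi>))"

definition isomorphism :: "'a fspace \<Rightarrow> 'b fspace \<Rightarrow> ('a \<Rightarrow> 'b) \<Rightarrow> bool" where
  "isomorphism X Y \<phi> \<longleftrightarrow> morphism X Y \<phi> \<and>
     (\<exists>\<psi>. morphism Y X \<psi> \<and> (\<forall>x\<in>points X. \<psi> (\<phi> x) = x) \<and> (\<forall>y\<in>points Y. \<phi> (\<psi> y) = y))"

definition locally_closed :: "'a fspace \<Rightarrow> 'a set \<Rightarrow> bool" where
  "locally_closed Y S \<longleftrightarrow> (\<exists>U C. openin (zariski Y) U \<and> closedin (zariski Y) C \<and> S = U \<inter> C)"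

definition subspace_fs :: "'a fspace \<Rightarrow> 'a set \<Rightarrow> 'a fspace" where
  "subspace_fs Y S =
    \<lparr>zariski = subtopology (zariski Y) S,
     regular = (\<lambda>U f. \<forall>u\<in>U. \<exists>V g. openin (zariski Y) V \<and> u \<in> V \<and> regular Y V g \<and>
                  (\<forall>w\<in>V \<inter> U. f w = g w))\<rparr>"

definition embedding :: "'a fspace \<Rightarrow> 'b fspace \<Rightarrow> ('a \<Rightarrow> 'b) \<Rightarrow> bool" where
  "embedding X Y \<phi> \<longleftrightarrow> morphism X Y \<phi> \<and> locally_closed Y (\<phi> ` points X) \<and>
     isomorphism X (subspace_fs Y (\<phi> ` points X)) \<phi>"

section \<open>Plane quartics with a hyperflex at infinity\<close>

datatype crd = cx | cy | cz

abbreviation "varX \<equiv> (var cx :: crd mpol)"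
abbreviation "varY \<equiv> (var cy :: crd mpol)"
abbreviation "varZ \<equiv> (var cz :: crd mpol)"

fun infinity_pt :: "crd \<Rightarrow> complex" where
  "infinity_pt cx = 0" | "infinity_pt cy = 1" | "infinity_pt cz = 0"

definition nonsingular :: "crd mpol \<Rightarrow> bool" where
  "nonsingular F \<longleftrightarrow> (\<forall>P. P \<noteq> (\<lambda>_. 0) \<longrightarrow> eval F P = 0 \<longrightarrow> (\<exists>i. eval (pd i F) P \<noteq> 0))"

text \<open>\<open>F(P + tQ)\<close> as a polynomial in \<open>t\<close>: the restriction of \<open>F\<close> to the line through
  \<open>P\<close> and \<open>Q\<close>, in a coordinate centred at \<open>P\<close>. Its order at \<open>t = 0\<close> is the multiplicity
  of \<open>P\<close> in the intersection of this line with the curve \<open>F = 0\<close>.\<close>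

definition restrict_line :: "crd mpol \<Rightarrow> (crd \<Rightarrow> complex) \<Rightarrow> (crd \<Rightarrow> complex) \<Rightarrow> complex poly" where
  "restrict_line F P Q = eval_via (\<lambda>c. [:c:]) (\<lambda>i. [:P i, Q i:]) F"

text \<open>The curve \<open>F = 0\<close> cuts the divisor \<open>4\<infinity>\<close> on the line \<open>z = 0\<close>.\<close>

definition cuts_four_infinity :: "crd mpol \<Rightarrow> bool" where
  "cuts_four_infinity F \<longleftrightarrow>
    (\<forall>P Q. P cz = 0 \<longrightarrow> Q cz = 0 \<longrightarrow> P cx * Q cy \<noteq> P cy * Q cx \<longrightarrow>
       restrict_line F P Q \<noteq> 0 \<and>
       order 0 (restrict_line F P Q) = (if \<exists>c. P = (\<lambda>i. c * infinity_pt i) then 4 else 0))"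

section \<open>The variety of decompositions \<open>F = AG + BH\<close>\<close>

datatype coef = a00 | a10 | a01 | b00 | b10 | b01 | g00 | g10 | g01 | g20 | g02
  | h00 | h10 | h01 | h20 | h11 | h02

text \<open>The conics are written as quadratic forms; setting \<open>z = 1\<close> gives their affine equations.\<close>

definition conicA :: "(coef \<Rightarrow> complex) \<Rightarrow> crd mpol" where
  "conicA c = const (c a00) * varZ^2 + const (c a10) * varX * varZ + const (c a01) * varY * varZ - varX^2"

definition conicB :: "(coef \<Rightarrow> complex) \<Rightarrow> crd mpol" where
  "conicB c = const (c b00) * varZ^2 + const (c b10) * varX * varZ + const (c b01) * varY * varZ - varX * varY"

definition conicG :: "(coef \<Rightarrow> complex) \<Rightarrow> crd mpol" where
  "conicG c = const (c g00) * varZ^2 + const (c g10) * varX * varZ + const (c g01) * varY * varZ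
     + const (c g20) * varX^2 + varX * varY + const (c g02) * varY^2"

definition conicH :: "(coef \<Rightarrow> complex) \<Rightarrow> crd mpol" where
  "conicH c = const (c h00) * varZ^2 + const (c h10) * varX * varZ + const (c h01) * varY * varZ
     + const (c h20) * varX^2 + const (c h11) * varX * varY + const (c h02) * varY^2"

definition Z_set :: "crd mpol \<Rightarrow> (coef \<Rightarrow> complex) set" where
  "Z_set F = {c. F = conicA c * conicG c + conicB c * conicH c}"

definition Z_variety :: "crd mpol \<Rightarrow> (coef \<Rightarrow> complex) fspace" where
  "Z_variety F = affine_variety (Z_set F)"

section \<open>The Grassmannian of lines in \<open>PV\<close>\<close>

definition conics_through_infinity :: "crd mpol set" where
  "conics_through_infinity = {q. homogeneous 2 q \<and> eval q infinity_pt = 0}"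

text \<open>A line in \<open>PV\<close> is represented by the corresponding two-dimensional subspace of
  \<open>V = conics_through_infinity\<close>.\<close>

definition pencil :: "crd mpol \<Rightarrow> crd mpol \<Rightarrow> crd mpol set" where
  "pencil A B = {const l * A + const m * B | l m. True}"

definition spanning_pair :: "crd mpol \<Rightarrow> crd mpol \<Rightarrow> bool" where
  "spanning_pair A B \<longleftrightarrow> A \<in> conics_through_infinity \<and> B \<in> conics_through_infinity \<and>
     (\<forall>l m. const l * A + const m * B = 0 \<longrightarrow> l = 0 \<and> m = 0)"

definition lines_PV :: "crd mpol set set" where
  "lines_PV = {pencil A B | A B. spanning_pair A B}"

text \<open>Pluecker coordinates with respect to the monomial basis. They are indexed by all pairs of
  exponents; the entries not belonging to two monomials of \<open>V\<close> vanish identically. The choice of a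
  basis changes them by a common nonzero factor only.\<close>

definition pluecker :: "crd mpol \<Rightarrow> crd mpol \<Rightarrow> (crd \<Rightarrow>\<^sub>0 nat) \<times> (crd \<Rightarrow>\<^sub>0 nat) \<Rightarrow> complex" where
  "pluecker A B = (\<lambda>(m, n). Poly_Mapping.lookup A m * Poly_Mapping.lookup B n
      - Poly_Mapping.lookup A n * Poly_Mapping.lookup B m)"

definition pluecker_coords :: "crd mpol set \<Rightarrow> (crd \<Rightarrow>\<^sub>0 nat) \<times> (crd \<Rightarrow>\<^sub>0 nat) \<Rightarrow> complex" where
  "pluecker_coords L = (SOME w. \<exists>A B. spanning_pair A B \<and> L = pencil A B \<and> w = pluecker A B)"

definition grassmannian_PV :: "crd mpol set fspace" where
  "grassmannian_PV = projective_variety pluecker_coords lines_PV"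

end

theory Submission
  imports Defs
begin

text \<open>
  Since \<open>F\<close> is non-singular at \<open>\<infinity>\<close> with tangent \<open>z = 0\<close>, its coefficient at \<open>y\<^sup>3z\<close> is nonzero. On \<open>Z\<close>
  this coefficient equals \<open>a01 * g02\<close>, so \<open>a01\<close> has no zero on \<open>Z\<close>. After inverting \<open>a01\<close>, the
  coefficient equations of \<open>F = AG + BH\<close> can be solved triangularly for \<open>G\<close> and \<open>H\<close>, which are
  thus regular functions of \<open>(A, B)\<close>. Moreover \<open>A\<close> and \<open>B\<close> are the basis of the pencil
  normalised at the monomials \<open>x\<^sup>2\<close> and \<open>xy\<close>, so they are ratios of Pluecker coordinates. On the open
  set where the \<open>(x\<^sup>2, xy)\<close> and \<open>(yz, xy)\<close> Pluecker coordinates are nonzero, this gives a regular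
  inverse, and the image is the closed subset on which the solved \<open>(A, B, G, H)\<close> satisfies
  \<open>F = AG + BH\<close>.
\<close>

section \<open>Evaluation of polynomials\<close>

definition mon_eval :: "('v \<Rightarrow> complex) \<Rightarrow> ('v \<Rightarrow>\<^sub>0 nat) \<Rightarrow> complex" where
  "mon_eval v m = (\<Prod>i\<in>Poly_Mapping.keys m. v i ^ Poly_Mapping.lookup m i)"

definition mon_deg :: "('v \<Rightarrow>\<^sub>0 nat) \<Rightarrow> nat" where
  "mon_deg m = (\<Sum>i\<in>Poly_Mapping.keys m. Poly_Mapping.lookup m i)"

lemma mon_eval_superset:
  assumes "finite I" "Poly_Mapping.keys m \<subseteq> I"
  shows "mon_eval v m = (\<Prod>i\<in>I. v i ^ Poly_Mapping.lookup m i)"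
  unfolding mon_eval_def using assms
  by (intro prod.mono_neutral_left) (auto simp: in_keys_iff)

lemma mon_deg_superset:
  assumes "finite I" "Poly_Mapping.keys m \<subseteq> I"
  shows "mon_deg m = (\<Sum>i\<in>I. Poly_Mapping.lookup m i)"
  unfolding mon_deg_def using assms
  by (intro sum.mono_neutral_left) (auto simp: in_keys_iff)

lemma mon_eval_add: "mon_eval v (m + n) = mon_eval v m * mon_eval v n"
proof -
  let ?I = "Poly_Mapping.keys m \<union> Poly_Mapping.keys n"
  have "Poly_Mapping.keys (m + n) \<subseteq> ?I"
    by (rule keys_add)
  then show ?thesis
    by (simp add: mon_eval_superset[of ?I] lookup_add power_add prod.distrib)
qed

lemma mon_deg_add: "mon_deg (m + n) = mon_deg m + mon_deg n"
proof -
  let ?I = "Poly_Mapping.keys m \<union> Poly_Mapping.keys n"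
  have "Poly_Mapping.keys (m + n) \<subseteq> ?I"
    by (rule keys_add)
  then show ?thesis
    by (simp add: mon_deg_superset[of ?I] lookup_add sum.distrib)
qed

lemma mon_eval_scale: "mon_eval (\<lambda>i. k * v i) m = k ^ mon_deg m * mon_eval v m"
  by (simp add: mon_eval_def mon_deg_def power_mult_distrib prod.distrib power_sum)

lemma homogeneous_iff: "homogeneous d p \<longleftrightarrow> (\<forall>m\<in>Poly_Mapping.keys p. mon_deg m = d)"
  by (simp add: homogeneous_def mon_deg_def)

lemma eval_eq: "eval p v = (\<Sum>m\<in>Poly_Mapping.keys p. Poly_Mapping.lookup p m * mon_eval v m)"
  by (simp add: eval_def eval_via_def mon_eval_def)

lemma eval_superset:
  assumes "finite M" "Poly_Mapping.keys p \<subseteq> M"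
  shows "eval p v = (\<Sum>m\<in>M. Poly_Mapping.lookup p m * mon_eval v m)"
  unfolding eval_eq using assms
  by (intro sum.mono_neutral_left) (auto simp: in_keys_iff)

lemma eval_single: "eval (Poly_Mapping.single m c) v = c * mon_eval v m"
  by (cases "c = 0") (auto simp: eval_eq)

lemma eval_const [simp]: "eval (const c) v = c"
  by (simp add: const_def eval_single mon_eval_def)

lemma eval_var [simp]: "eval (var i) v = v i"
  by (simp add: var_def eval_single mon_eval_def)

lemma eval_add [simp]: "eval (p + q) v = eval p v + eval q v"
proof -
  let ?M = "Poly_Mapping.keys p \<union> Poly_Mapping.keys q"
  have "Poly_Mapping.keys (p + q) \<subseteq> ?M"
    by (rule keys_add)
  then show ?thesis
    by (simp add: eval_superset[of ?M] lookup_add sum.distrib distrib_right)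
qed

lemma eval_sum: "eval (sum f A) v = (\<Sum>a\<in>A. eval (f a) v)"
  by (induction A rule: infinite_finite_induct) (auto simp: eval_eq[of 0])

lemma poly_eq_sum_single:
  "p = (\<Sum>m\<in>Poly_Mapping.keys p. Poly_Mapping.single m (Poly_Mapping.lookup p m))"
  by (rule poly_mapping_eqI)
    (auto simp: lookup_sum lookup_single when_def in_keys_iff sum.delta[OF finite_keys])

lemma eval_mult [simp]: "eval (p * q) v = eval p v * eval q v"
proof -
  have "p * q = (\<Sum>m\<in>Poly_Mapping.keys p. \<Sum>n\<in>Poly_Mapping.keys q.
      Poly_Mapping.single (m + n) (Poly_Mapping.lookup p m * Poly_Mapping.lookup q n))"
    by (subst poly_eq_sum_single[of p], subst poly_eq_sum_single[of q])
      (simp add: sum_product mult_single)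
  then have "eval (p * q) v = (\<Sum>m\<in>Poly_Mapping.keys p. \<Sum>n\<in>Poly_Mapping.keys q.
      (Poly_Mapping.lookup p m * mon_eval v m) * (Poly_Mapping.lookup q n * mon_eval v n))"
    by (simp add: eval_sum eval_single mon_eval_add mult_ac)
  then show ?thesis
    by (simp add: eval_eq sum_product)
qed

lemma homogeneous_const: "homogeneous 0 (const c)"
  by (cases "c = 0") (auto simp: homogeneous_iff const_def mon_deg_def)

lemma homogeneous_var: "homogeneous 1 (var i)"
  by (simp add: homogeneous_iff var_def mon_deg_def)

lemma homogeneous_add: "homogeneous d p \<Longrightarrow> homogeneous d q \<Longrightarrow> homogeneous d (p + q)"
  using keys_add[of p q] by (auto simp: homogeneous_iff)

lemma homogeneous_mult:
  assumes "homogeneous d p" "homogeneous e q"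
  shows "homogeneous (d + e) (p * q)"
  using keys_mult[of p q] assms by (fastforce simp: homogeneous_iff mon_deg_add)

lemma eval_scale:
  assumes "homogeneous d p"
  shows "eval p (\<lambda>i. k * v i) = k ^ d * eval p v"
  using assms by (simp add: eval_eq homogeneous_iff mon_eval_scale sum_distrib_left mult_ac)

section \<open>Algebras of functions\<close>

text \<open>Polynomials in the parameters and homogeneous fractions on the Grassmannian are both
  instances, so explicit formulas are checked by the same closure rules in both settings.\<close>

definition function_algebra :: "('a \<Rightarrow> complex) set \<Rightarrow> bool" where
  "function_algebra \<A> \<longleftrightarrow> (\<forall>k. (\<lambda>_. k) \<in> \<A>) \<and>
     (\<forall>f\<in>\<A>. \<forall>g\<in>\<A>. (\<lambda>s. f s + g s) \<in> \<A> \<and> (\<lambda>s. f s * g s) \<in> \<A>)"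

context
  fixes \<A> :: "('a \<Rightarrow> complex) set"
  assumes alg: "function_algebra \<A>"
begin

lemma fa_const: "(\<lambda>_. k) \<in> \<A>"
  using alg by (simp add: function_algebra_def)

lemma fa_add: "f \<in> \<A> \<Longrightarrow> g \<in> \<A> \<Longrightarrow> (\<lambda>s. f s + g s) \<in> \<A>"
  using alg by (simp add: function_algebra_def)

lemma fa_mult: "f \<in> \<A> \<Longrightarrow> g \<in> \<A> \<Longrightarrow> (\<lambda>s. f s * g s) \<in> \<A>"
  using alg by (simp add: function_algebra_def)

lemma fa_minus: "f \<in> \<A> \<Longrightarrow> (\<lambda>s. - f s) \<in> \<A>"
  using fa_mult[OF fa_const[of "-1"]] by simp

lemma fa_diff: "f \<in> \<A> \<Longrightarrow> g \<in> \<A> \<Longrightarrow> (\<lambda>s. f s - g s) \<in> \<A>"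
  using fa_add[OF _ fa_minus] by simp

text \<open>\<open>lookup_single\<close> produces such conditionals; \<open>P\<close> compares
  exponents and does not depend on the point.\<close>

lemma fa_when: "f \<in> \<A> \<Longrightarrow> (\<lambda>s. f s when P) \<in> \<A>"
  using fa_const[of 0] by (cases P) auto

lemma fa_sum: "(\<And>i. i \<in> I \<Longrightarrow> f i \<in> \<A>) \<Longrightarrow> (\<lambda>s. \<Sum>i\<in>I. f i s) \<in> \<A>"
  by (induction I rule: infinite_finite_induct) (auto intro: fa_const fa_add)

lemma fa_power: "f \<in> \<A> \<Longrightarrow> (\<lambda>s. f s ^ n) \<in> \<A>"
  by (induction n) (auto intro: fa_const fa_mult)

lemma fa_prod: "(\<And>i. i \<in> I \<Longrightarrow> f i \<in> \<A>) \<Longrightarrow> (\<lambda>s. \<Prod>i\<in>I. f i s) \<in> \<A>"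
  by (induction I rule: infinite_finite_induct) (auto intro: fa_const fa_mult)

lemma fa_eval: "(\<And>i. (\<lambda>s. v s i) \<in> \<A>) \<Longrightarrow> (\<lambda>s. eval p (v s)) \<in> \<A>"
  unfolding eval_eq mon_eval_def by (intro fa_sum fa_mult fa_const fa_prod fa_power)

end

lemmas fa_intros = fa_const fa_add fa_mult fa_minus fa_diff fa_when

lemma function_algebra_polynomials: "function_algebra (range eval)"
  unfolding function_algebra_def
proof (intro conjI allI ballI)
  show "(\<lambda>_. k) \<in> range eval" for k
    by (rule range_eqI[of _ _ "const k"]) auto
  fix f g :: "('a \<Rightarrow> complex) \<Rightarrow> complex"
  assume "f \<in> range eval" "g \<in> range eval"
  then obtain p q where "f = eval p" "g = eval q"
    by auto
  then have "(\<lambda>s. f s + g s) = eval (p + q)" "(\<lambda>s. f s * g s) = eval (p * q)"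
    by auto
  then show "(\<lambda>s. f s + g s) \<in> range eval" "(\<lambda>s. f s * g s) \<in> range eval"
    by simp_all
qed

lemma coordinate_polynomial: "(\<lambda>c. c i) \<in> range eval"
  by (rule range_eqI[of _ _ "var i"]) auto

text \<open>A single fraction represents \<open>f\<close> on all of \<open>T\<close>, so zero loci
  can be read off from one numerator. Off \<open>T\<close> the values are free.\<close>

definition homogeneous_fractions :: "('a \<Rightarrow> 'v \<Rightarrow> complex) \<Rightarrow> 'a set \<Rightarrow> ('a \<Rightarrow> complex) set" where
  "homogeneous_fractions h T = {f. \<exists>d p q. homogeneous d p \<and> homogeneous d q \<and>
     (\<forall>s\<in>T. eval q (h s) \<noteq> 0 \<and> f s = eval p (h s) / eval q (h s))}"

lemma homogeneous_fractionsI: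
  assumes "homogeneous d p" "homogeneous d q"
    "\<And>s. s \<in> T \<Longrightarrow> eval q (h s) \<noteq> 0"
    "\<And>s. s \<in> T \<Longrightarrow> f s = eval p (h s) / eval q (h s)"
  shows "f \<in> homogeneous_fractions h T"
  using assms unfolding homogeneous_fractions_def by blast

lemma function_algebra_homogeneous_fractions: "function_algebra (homogeneous_fractions h T)"
  unfolding function_algebra_def
proof (intro conjI allI ballI)
  show "(\<lambda>_. k) \<in> homogeneous_fractions h T" for k
    by (rule homogeneous_fractionsI[OF homogeneous_const homogeneous_const[of 1]]) auto
  fix f f'
  assume "f \<in> homogeneous_fractions h T" "f' \<in> homogeneous_fractions h T"
  then obtain d p q d' p' q' where
    *: "homogeneous d p" "homogeneous d q" "homogeneous d' p'" "homogeneous d' q'"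
    and **: "\<And>s. s \<in> T \<Longrightarrow> eval q (h s) \<noteq> 0 \<and> f s = eval p (h s) / eval q (h s)"
      "\<And>s. s \<in> T \<Longrightarrow> eval q' (h s) \<noteq> 0 \<and> f' s = eval p' (h s) / eval q' (h s)"
    unfolding homogeneous_fractions_def by blast
  have deg: "homogeneous (d + d') (p * q' + q * p')" "homogeneous (d + d') (p * p')"
    "homogeneous (d + d') (q * q')"
    using * by (auto intro: homogeneous_add homogeneous_mult)
  show "(\<lambda>s. f s + f' s) \<in> homogeneous_fractions h T"
    by (rule homogeneous_fractionsI[OF deg(1,3)]) (use ** in \<open>auto simp: field_simps\<close>)
  show "(\<lambda>s. f s * f' s) \<in> homogeneous_fractions h T"
    by (rule homogeneous_fractionsI[OF deg(2,3)]) (use ** in auto)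
qed

lemma homogeneous_fractions_divide:
  assumes "f \<in> homogeneous_fractions h T" "g \<in> homogeneous_fractions h T"
    "\<And>s. s \<in> T \<Longrightarrow> g s \<noteq> 0"
  shows "(\<lambda>s. f s / g s) \<in> homogeneous_fractions h T"
proof -
  obtain d p q where deg: "homogeneous d p" "homogeneous d q"
    and g: "\<And>s. s \<in> T \<Longrightarrow> eval q (h s) \<noteq> 0 \<and> g s = eval p (h s) / eval q (h s)"
    using assms(2) unfolding homogeneous_fractions_def by blast
  have "(\<lambda>s. inverse (g s)) \<in> homogeneous_fractions h T"
    by (rule homogeneous_fractionsI[OF deg(2,1)]) (use g assms(3) in auto)
  then show ?thesis
    using fa_mult[OF function_algebra_homogeneous_fractions assms(1)]
    by (simp add: divide_inverse)
qed

lemma coordinate_quotient: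
  assumes "\<And>s. s \<in> T \<Longrightarrow> h s j \<noteq> 0"
  shows "(\<lambda>s. h s i / h s j) \<in> homogeneous_fractions h T"
  by (rule homogeneous_fractionsI[OF homogeneous_var[of i] homogeneous_var[of j]]) (use assms in auto)

section \<open>Morphisms of fraction spaces\<close>

lemma openin_nonzero:
  "(p, q) \<in> R \<Longrightarrow> openin (zariski (fraction_space S R)) {s \<in> S. q s \<noteq> 0}"
  unfolding fraction_space_def Let_def by (auto intro!: topology_generated_by_Basis)

lemma points_fraction_space:
  assumes "(\<lambda>_. 1, \<lambda>_. 1) \<in> R"
  shows "points (fraction_space S R) = S"
proof
  show "points (fraction_space S R) \<subseteq> S"
    unfolding fraction_space_def Let_def by auto
  show "S \<subseteq> points (fraction_space S R)"
    using openin_subset[OF openin_nonzero[OF assms, of S]] by auto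
qed

lemma regular_fraction_space:
  "regular (fraction_space S R) U f \<longleftrightarrow>
    (\<forall>u\<in>U. \<exists>W p q. openin (zariski (fraction_space S R)) W \<and> u \<in> W \<and> W \<subseteq> U \<and> (p, q) \<in> R \<and>
       (\<forall>w\<in>W. q w \<noteq> 0 \<and> f w = p w / q w))"
  by (simp add: fraction_space_def Let_def)

lemma regular_fraction_spaceE:
  assumes "regular (fraction_space S R) U f" "u \<in> U"
  obtains W p q where "openin (zariski (fraction_space S R)) W" "u \<in> W" "W \<subseteq> U" "(p, q) \<in> R"
    "\<And>w. w \<in> W \<Longrightarrow> q w \<noteq> 0 \<and> f w = p w / q w"
  using bspec[OF assms(1)[unfolded regular_fraction_space] assms(2)] by blast

text \<open>The loci \<open>q \<noteq> 0\<close> generate the topology and regular functions are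
  locally fractions, so it is enough to pull each fraction back to one whose denominator vanishes at
  the corresponding points of \<open>S\<close>.\<close>

lemma morphism_fraction_space:
  assumes one: "(\<lambda>_. 1, \<lambda>_. 1) \<in> R" "(\<lambda>_. 1, \<lambda>_. 1) \<in> R'"
    and maps: "\<phi> ` S \<subseteq> S'"
    and pullback: "\<And>p q. (p, q) \<in> R' \<Longrightarrow> \<exists>p' q'. (p', q') \<in> R \<and>
      (\<forall>s\<in>S. (q' s \<noteq> 0 \<longleftrightarrow> q (\<phi> s) \<noteq> 0) \<and> (q (\<phi> s) \<noteq> 0 \<longrightarrow> p' s / q' s = p (\<phi> s) / q (\<phi> s)))"
  shows "morphism (fraction_space S R) (fraction_space S' R') \<phi>"
proof -
  let ?X = "fraction_space S R" and ?Y = "fraction_space S' R'"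
  note pts = points_fraction_space[OF one(1), of S] points_fraction_space[OF one(2), of S']
  have gen: "zariski ?Y = topology_generated_by {{s \<in> S'. q s \<noteq> 0} | p q. (p, q) \<in> R'}"
    by (simp add: fraction_space_def Let_def)
  have cont: "continuous_map (zariski ?X) (zariski ?Y) \<phi>"
    unfolding gen
  proof (rule continuous_on_generated_topo)
    fix B assume "B \<in> {{s \<in> S'. q s \<noteq> 0} | p q. (p, q) \<in> R'}"
    then obtain p q where pq: "(p, q) \<in> R'" "B = {s \<in> S'. q s \<noteq> 0}"
      by auto
    obtain p' q' where "(p', q') \<in> R" "\<forall>s\<in>S. q' s \<noteq> 0 \<longleftrightarrow> q (\<phi> s) \<noteq> 0"
      using pullback[OF pq(1)] by auto
    moreover from this have "\<phi> -` B \<inter> points ?X = {s \<in> S. q' s \<noteq> 0}"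
      using maps pq(2) by (auto simp: pts)
    ultimately show "openin (zariski ?X) (\<phi> -` B \<inter> points ?X)"
      by (simp add: openin_nonzero)
  next
    have "\<Union> {{s \<in> S'. q s \<noteq> 0} | p q. (p, q) \<in> R'} = S'"
      using pts(2) unfolding gen topology_generated_by_topspace .
    then show "\<phi> ` points ?X \<subseteq> \<Union> {{s \<in> S'. q s \<noteq> 0} | p q. (p, q) \<in> R'}"
      using maps by (simp only: pts(1))
  qed
  moreover have "regular ?X {x \<in> points ?X. \<phi> x \<in> V} (f \<circ> \<phi>)"
    if "openin (zariski ?Y) V" and reg: "regular ?Y V f" for V f
    unfolding regular_fraction_space
  proof
    fix u assume u: "u \<in> {x \<in> points ?X. \<phi> x \<in> V}"
    then have "\<phi> u \<in> V"
      by simp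
    with reg obtain W p q where W: "openin (zariski ?Y) W" "\<phi> u \<in> W" "W \<subseteq> V" "(p, q) \<in> R'"
      "\<And>w. w \<in> W \<Longrightarrow> q w \<noteq> 0 \<and> f w = p w / q w"
      by (rule regular_fraction_spaceE) blast
    obtain p' q' where pq': "(p', q') \<in> R" "\<forall>s\<in>S. (q' s \<noteq> 0 \<longleftrightarrow> q (\<phi> s) \<noteq> 0) \<and>
        (q (\<phi> s) \<noteq> 0 \<longrightarrow> p' s / q' s = p (\<phi> s) / q (\<phi> s))"
      using pullback[OF W(4)] by blast
    have W': "openin (zariski ?X) {x \<in> points ?X. \<phi> x \<in> W}"
      using cont W(1) by (rule openin_continuous_map_preimage)
    show "\<exists>W p q. openin (zariski ?X) W \<and> u \<in> W \<and> W \<subseteq> {x \<in> points ?X. \<phi> x \<in> V} \<and>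
        (p, q) \<in> R \<and> (\<forall>w\<in>W. q w \<noteq> 0 \<and> (f \<circ> \<phi>) w = p w / q w)"
      by (rule exI[of _ "{x \<in> points ?X. \<phi> x \<in> W}"], rule exI[of _ p'], rule exI[of _ q'])
        (use u W W' pq' pts(1) in auto)
  qed
  ultimately show ?thesis
    by (simp add: morphism_def)
qed

text \<open>The generators for \<open>T\<close> are the traces of those for \<open>S\<close>. One
  direction is continuity of the inclusion, the other an induction over the generated
  topology.\<close>

lemma zariski_subspace_fraction_space:
  assumes one: "(\<lambda>_. 1, \<lambda>_. 1) \<in> R" and "T \<subseteq> S"
  shows "zariski (subspace_fs (fraction_space S R) T) = zariski (fraction_space T R)"
proof (rule topology_eq[THEN iffD2], intro allI iffI)
  let ?Y = "fraction_space S R"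
  have gen: "zariski (fraction_space S R) =
      topology_generated_by {{s \<in> S. q s \<noteq> 0} | p q. (p, q) \<in> R}" for S
    by (simp add: fraction_space_def Let_def)
  have "morphism (fraction_space T R) ?Y id"
    by (rule morphism_fraction_space[OF one one]) (use assms(2) in auto)
  then have cont: "continuous_map (zariski (fraction_space T R)) (zariski ?Y) id"
    by (simp add: morphism_def)
  have "openin (zariski (fraction_space T R)) (V \<inter> T)" if "openin (zariski ?Y) V" for V
    using openin_continuous_map_preimage[OF cont that] points_fraction_space[OF one, of T]
    by (simp add: Int_def conj_commute)
  then show "openin (zariski (fraction_space T R)) U"
    if "openin (zariski (subspace_fs ?Y T)) U" for U
    using that by (auto simp: subspace_fs_def openin_subtopology)
  have "generate_topology_on {{s \<in> T. q s \<noteq> 0} | p q. (p, q) \<in> R} U \<Longrightarrow>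
      openin (subtopology (zariski ?Y) T) U" for U
  proof (induction rule: generate_topology_on.induct)
    case (Basis B)
    then obtain p q where "(p, q) \<in> R" "B = {s \<in> S. q s \<noteq> 0} \<inter> T"
      using assms(2) by auto
    then show ?case
      unfolding openin_subtopology using openin_nonzero by blast
  qed auto
  then show "openin (zariski (subspace_fs ?Y T)) U"
    if "openin (zariski (fraction_space T R)) U" for U
    using that by (simp add: gen subspace_fs_def openin_topology_generated_by_iff)
qed

lemma regular_subspace_fraction_space:
  assumes one: "(\<lambda>_. 1, \<lambda>_. 1) \<in> R" and "T \<subseteq> S"
    and U: "openin (zariski (fraction_space T R)) U"
  shows "regular (subspace_fs (fraction_space S R) T) U f \<longleftrightarrow> regular (fraction_space T R) U f"
proof
  let ?Y = "fraction_space S R" and ?X = "fraction_space T R"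
  have open_iff: "openin (zariski ?X) W \<longleftrightarrow> (\<exists>V. openin (zariski ?Y) V \<and> W = V \<inter> T)" for W
    unfolding zariski_subspace_fraction_space[OF assms(1,2), symmetric]
    by (simp add: subspace_fs_def openin_subtopology)
  have UT: "U \<subseteq> T"
    using openin_subset[OF U] points_fraction_space[OF one] by auto
  {
    assume reg: "regular (subspace_fs ?Y T) U f"
    show "regular ?X U f"
      unfolding regular_fraction_space
    proof
      fix u assume u: "u \<in> U"
      then obtain V g where V: "openin (zariski ?Y) V" "u \<in> V" "regular ?Y V g" "\<forall>w\<in>V \<inter> U. f w = g w"
        using reg by (auto simp: subspace_fs_def)
      obtain W p q where W: "openin (zariski ?Y) W" "u \<in> W" "W \<subseteq> V" "(p, q) \<in> R"
        "\<And>w. w \<in> W \<Longrightarrow> q w \<noteq> 0 \<and> g w = p w / q w"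
        using V(3,2) by (rule regular_fraction_spaceE) blast
      have W': "openin (zariski ?X) (W \<inter> T \<inter> U)"
        using W(1) U open_iff by blast
      show "\<exists>W p q. openin (zariski ?X) W \<and> u \<in> W \<and> W \<subseteq> U \<and> (p, q) \<in> R \<and>
          (\<forall>w\<in>W. q w \<noteq> 0 \<and> f w = p w / q w)"
        by (rule exI[of _ "W \<inter> T \<inter> U"], rule exI[of _ p], rule exI[of _ q])
          (use u V(2,4) W W' UT in auto)
    qed
  }
  {
    assume reg: "regular ?X U f"
    have "\<exists>V g. openin (zariski ?Y) V \<and> u \<in> V \<and> regular ?Y V g \<and> (\<forall>w\<in>V \<inter> U. f w = g w)"
      if "u \<in> U" for u
    proof -
      obtain W p q where W: "openin (zariski ?X) W" "u \<in> W" "W \<subseteq> U" "(p, q) \<in> R"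
        "\<And>w. w \<in> W \<Longrightarrow> q w \<noteq> 0 \<and> f w = p w / q w"
        using reg \<open>u \<in> U\<close> by (rule regular_fraction_spaceE) blast
      from W(1) obtain V where V: "openin (zariski ?Y) V" "W = V \<inter> T"
        using open_iff by blast
      \<comment> \<open>The denominator \<open>q\<close> has no zero on the trace \<open>W\<close>,
        but may have zeros on \<open>V\<close> outside \<open>T\<close>; these are removed.\<close>
      let ?V = "V \<inter> {s \<in> S. q s \<noteq> 0}"
      have "openin (zariski ?Y) ?V"
        using V(1) openin_nonzero[OF W(4)] by (rule openin_Int)
      moreover from this have "regular ?Y ?V (\<lambda>w. p w / q w)"
        unfolding regular_fraction_space using W(4) by blast
      ultimately show ?thesis
        using that W(2,5) V(2) UT assms(2)
        by (intro exI[of _ ?V] exI[of _ "\<lambda>w. p w / q w"]) auto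
    qed
    then show "regular (subspace_fs ?Y T) U f"
      by (simp add: subspace_fs_def)
  }
qed

text \<open>\<open>morphism\<close> tests regularity over open sets of the target, where the two
  structures on \<open>T\<close> agree.\<close>

lemma morphism_into_subspace:
  assumes one: "(\<lambda>_. 1, \<lambda>_. 1) \<in> R" and "T \<subseteq> S"
  shows "morphism X (subspace_fs (fraction_space S R) T) \<phi> \<longleftrightarrow> morphism X (fraction_space T R) \<phi>"
  unfolding morphism_def
  by (simp add: zariski_subspace_fraction_space[OF assms] regular_subspace_fraction_space[OF assms]
      cong: conj_cong)

lemma morphism_from_subspace:
  assumes one: "(\<lambda>_. 1, \<lambda>_. 1) \<in> R" and "T \<subseteq> S"
  shows "morphism (subspace_fs (fraction_space S R) T) X \<phi> \<longleftrightarrow> morphism (fraction_space T R) X \<phi>"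
  unfolding morphism_def
  by (auto simp: zariski_subspace_fraction_space[OF assms]
      regular_subspace_fraction_space[OF assms] openin_continuous_map_preimage)

section \<open>Ternary forms\<close>

definition mon :: "nat \<Rightarrow> nat \<Rightarrow> nat \<Rightarrow> crd \<Rightarrow>\<^sub>0 nat" where
  "mon i j k = Poly_Mapping.single cx i + Poly_Mapping.single cy j + Poly_Mapping.single cz k"

lemma UNIV_crd: "UNIV = {cx, cy, cz}"
  using crd.exhaust by auto

lemma finite_crd: "finite (UNIV :: crd set)"
  by (simp add: UNIV_crd)

lemma lookup_mon [simp]:
  "Poly_Mapping.lookup (mon i j k) cx = i"
  "Poly_Mapping.lookup (mon i j k) cy = j"
  "Poly_Mapping.lookup (mon i j k) cz = k"
  by (simp_all add: mon_def lookup_add lookup_single)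

lemma mon_cases:
  obtains i j k where "m = mon i j k"
proof
  show "m = mon (Poly_Mapping.lookup m cx) (Poly_Mapping.lookup m cy) (Poly_Mapping.lookup m cz)"
    by (rule poly_mapping_eqI, case_tac k) simp_all
qed

lemma mon_eq_iff [simp]: "mon i j k = mon i' j' k' \<longleftrightarrow> i = i' \<and> j = j' \<and> k = k'"
  by (metis lookup_mon)

lemma mon_add [simp]: "mon i j k + mon i' j' k' = mon (i + i') (j + j') (k + k')"
  by (simp add: mon_def single_add algebra_simps)

lemma mon_deg_mon [simp]: "mon_deg (mon i j k) = i + j + k"
  using mon_deg_superset[OF _ subset_UNIV, of "mon i j k"] by (simp add: UNIV_crd)

lemma mon_eval_mon [simp]: "mon_eval v (mon i j k) = v cx ^ i * v cy ^ j * v cz ^ k"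
  using mon_eval_superset[OF _ subset_UNIV, where m = "mon i j k" and v = v] by (simp add: UNIV_crd)

lemma const_mon: "const c = Poly_Mapping.single (mon 0 0 0) c"
  by (simp add: const_def mon_def)

lemma var_mon:
  "varX = Poly_Mapping.single (mon 1 0 0) 1"
  "varY = Poly_Mapping.single (mon 0 1 0) 1"
  "varZ = Poly_Mapping.single (mon 0 0 1) 1"
  by (simp_all add: var_def mon_def)

lemma lookup_const_mult: "Poly_Mapping.lookup (const c * p) m = c * Poly_Mapping.lookup p m"
proof -
  have "const c * p = (\<Sum>n\<in>Poly_Mapping.keys p. Poly_Mapping.single n (c * Poly_Mapping.lookup p n))"
    by (subst poly_eq_sum_single[of p]) (simp add: const_def sum_distrib_left mult_single)
  then show ?thesis
    by (auto simp: lookup_sum lookup_single when_def in_keys_iff sum.delta[OF finite_keys])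
qed

lemma lookup_pencil:
  "Poly_Mapping.lookup (const l * A + const m * B) n =
    l * Poly_Mapping.lookup A n + m * Poly_Mapping.lookup B n"
  by (simp add: lookup_add lookup_const_mult)

lemmas mon_simps = const_mon var_mon mult_single power2_eq_square single_uminus[symmetric]

lemma conicA_eq: "conicA c = Poly_Mapping.single (mon 0 0 2) (c a00)
    + Poly_Mapping.single (mon 1 0 1) (c a10) + Poly_Mapping.single (mon 0 1 1) (c a01)
    + Poly_Mapping.single (mon 2 0 0) (- 1)"
  by (simp add: conicA_def mon_simps diff_conv_add_uminus numeral_2_eq_2 del: add_uminus_conv_diff)

lemma conicB_eq: "conicB c = Poly_Mapping.single (mon 0 0 2) (c b00)
    + Poly_Mapping.single (mon 1 0 1) (c b10) + Poly_Mapping.single (mon 0 1 1) (c b01)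
    + Poly_Mapping.single (mon 1 1 0) (- 1)"
  by (simp add: conicB_def mon_simps diff_conv_add_uminus numeral_2_eq_2 del: add_uminus_conv_diff)

lemma conicG_eq: "conicG c = Poly_Mapping.single (mon 0 0 2) (c g00)
    + Poly_Mapping.single (mon 1 0 1) (c g10) + Poly_Mapping.single (mon 0 1 1) (c g01)
    + Poly_Mapping.single (mon 2 0 0) (c g20) + Poly_Mapping.single (mon 1 1 0) 1
    + Poly_Mapping.single (mon 0 2 0) (c g02)"
  by (simp add: conicG_def mon_simps numeral_2_eq_2)

lemma conicH_eq: "conicH c = Poly_Mapping.single (mon 0 0 2) (c h00)
    + Poly_Mapping.single (mon 1 0 1) (c h10) + Poly_Mapping.single (mon 0 1 1) (c h01)
    + Poly_Mapping.single (mon 2 0 0) (c h20) + Poly_Mapping.single (mon 1 1 0) (c h11)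
    + Poly_Mapping.single (mon 0 2 0) (c h02)"
  by (simp add: conicH_def mon_simps numeral_2_eq_2)

section \<open>Coefficients of AG + BH\<close>

abbreviation decomposition_form :: "(coef \<Rightarrow> complex) \<Rightarrow> crd mpol" where
  "decomposition_form c \<equiv> conicA c * conicG c + conicB c * conicH c"

text \<open>Every coefficient of AG + BH is a polynomial in the entries of \<open>c\<close>.\<close>

lemma fa_lookup_decomposition_form:
  assumes alg: "function_algebra \<A>" and c: "\<And>i. (\<lambda>s. c s i) \<in> \<A>"
  shows "(\<lambda>s. Poly_Mapping.lookup (decomposition_form (c s)) m) \<in> \<A>"
  unfolding conicA_eq conicB_eq conicG_eq conicH_eq distrib_left distrib_right mult_single
    lookup_add lookup_single
  by (intro fa_intros[OF alg] c)

text \<open>The coefficient of \<open>y^4\<close> is 0 because neither A nor B has a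
  \<open>y^2\<close> term. The other eleven determine G and H from A and B once \<open>a01\<close>
  is nonzero.\<close>

lemma decomposition_form_coeffs:
  "Poly_Mapping.lookup (decomposition_form c) (mon 4 0 0) = - c g20"
  "Poly_Mapping.lookup (decomposition_form c) (mon 3 1 0) = - 1 - c h20"
  "Poly_Mapping.lookup (decomposition_form c) (mon 2 2 0) = - c g02 - c h11"
  "Poly_Mapping.lookup (decomposition_form c) (mon 1 3 0) = - c h02"
  "Poly_Mapping.lookup (decomposition_form c) (mon 0 4 0) = 0"
  "Poly_Mapping.lookup (decomposition_form c) (mon 0 3 1) = c a01 * c g02 + c b01 * c h02"
  "Poly_Mapping.lookup (decomposition_form c) (mon 3 0 1) = - c g10 + c a10 * c g20 + c b10 * c h20"
  "Poly_Mapping.lookup (decomposition_form c) (mon 1 2 1) =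
     c a10 * c g02 + c a01 - c h01 + c b10 * c h02 + c b01 * c h11"
  "Poly_Mapping.lookup (decomposition_form c) (mon 0 2 2) =
     c a01 * c g01 + c a00 * c g02 + c b01 * c h01 + c b00 * c h02"
  "Poly_Mapping.lookup (decomposition_form c) (mon 2 1 1) =
     - c g01 + c a10 + c a01 * c g20 - c h10 + c b10 * c h11 + c b01 * c h20"
  "Poly_Mapping.lookup (decomposition_form c) (mon 2 0 2) =
     - c g00 + c a10 * c g10 + c a00 * c g20 + c b10 * c h10 + c b00 * c h20"
  "Poly_Mapping.lookup (decomposition_form c) (mon 1 1 2) =
     c a10 * c g01 + c a01 * c g10 + c a00 - c h00 + c b10 * c h01 + c b01 * c h10 + c b00 * c h11"
  by (simp_all add: conicA_eq conicB_eq conicG_eq conicH_eq distrib_left distrib_right mult_single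
      lookup_add lookup_single)

text \<open>Of the monomials of degree \<open>d\<close>, only \<open>y^d\<close> is nonzero at
  (0:1:0).\<close>

lemma eval_infinity_pt:
  assumes "homogeneous d p"
  shows "eval p infinity_pt = Poly_Mapping.lookup p (mon 0 d 0)"
proof -
  have "Poly_Mapping.lookup p m * mon_eval infinity_pt m =
      (if m = mon 0 d 0 then Poly_Mapping.lookup p m else 0)" if "m \<in> Poly_Mapping.keys p" for m
    using assms that by (cases m rule: mon_cases) (auto simp: homogeneous_iff power_0_left)
  then show ?thesis
    by (simp add: eval_eq sum.delta in_keys_iff)
qed

text \<open>Along the line \<open>z = 0\<close> the form becomes F(t,1,0), which vanishes to order 4
  at t = 0; its linear coefficient is that of \<open>xy^3\<close>.\<close>

lemma hyperflex_coeff_xy3: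
  assumes hom: "homogeneous 4 F" and cuts: "cuts_four_infinity F"
  shows "Poly_Mapping.lookup F (mon 1 3 0) = 0"
proof -
  \<comment> \<open>\<open>Q\<close> is (1:0:0), which together with \<open>infinity_pt\<close>
    spans the line \<open>z = 0\<close>; the moving point is (t:1:0).\<close>
  define Q :: "crd \<Rightarrow> complex" where "Q i = (if i = cx then 1 else 0)" for i
  define r where "r = restrict_line F infinity_pt Q"
  have "\<exists>c. infinity_pt = (\<lambda>i. c * infinity_pt i)"
    by (rule exI[of _ 1]) auto
  then have "order 0 r = 4"
    using cuts[unfolded cuts_four_infinity_def, rule_format, of infinity_pt Q]
    by (simp add: Q_def r_def)
  then have "monom 1 4 dvd r"
    using order_1[of 0 r] by (simp add: monom_altdef)
  then have "coeff r 1 = 0"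
    by (simp add: monom_1_dvd_iff')
  have prod: "(\<Prod>n\<in>Poly_Mapping.keys (mon i j k). [:infinity_pt n, Q n:] ^ Poly_Mapping.lookup (mon i j k) n)
      = (if k = 0 then monom 1 i else 0)" for i j k
  proof -
    have "(\<Prod>n\<in>Poly_Mapping.keys (mon i j k). [:infinity_pt n, Q n:] ^ Poly_Mapping.lookup (mon i j k) n)
        = (\<Prod>n\<in>{cx, cy, cz}. [:infinity_pt n, Q n:] ^ Poly_Mapping.lookup (mon i j k) n)"
      using UNIV_crd finite_crd by (intro prod.mono_neutral_left) (auto simp: in_keys_iff)
    then show ?thesis
      by (simp add: Q_def monom_altdef power_0_left flip: one_pCons)
  qed
  have "coeff ([:Poly_Mapping.lookup F m:] * (\<Prod>i\<in>Poly_Mapping.keys m.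
      [:infinity_pt i, Q i:] ^ Poly_Mapping.lookup m i)) 1 =
      (if m = mon 1 3 0 then Poly_Mapping.lookup F m else 0)" if "m \<in> Poly_Mapping.keys F" for m
    using hom that by (cases m rule: mon_cases) (auto simp: homogeneous_iff prod)
  then have "coeff r 1 = Poly_Mapping.lookup F (mon 1 3 0)"
    unfolding r_def restrict_line_def eval_via_def coeff_sum
    by (simp add: sum.delta in_keys_iff)
  with \<open>coeff r 1 = 0\<close> show ?thesis
    by simp
qed

text \<open>At (0:1:0) the partial derivatives of F by x, y, z are the coefficient of
  \<open>xy^3\<close>, four times that of \<open>y^4\<close>, and that of \<open>y^3z\<close>. If
  all three coefficients were zero, the curve would be singular there.\<close>

lemma nonsingular_coeff_y3z:
  assumes hom: "homogeneous 4 F" and "nonsingular F"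
    and y4: "Poly_Mapping.lookup F (mon 0 4 0) = 0" and xy3: "Poly_Mapping.lookup F (mon 1 3 0) = 0"
  shows "Poly_Mapping.lookup F (mon 0 3 1) \<noteq> 0"
proof
  assume y3z: "Poly_Mapping.lookup F (mon 0 3 1) = 0"
  have "infinity_pt cy \<noteq> 0"
    by simp
  then have "infinity_pt \<noteq> (\<lambda>_. 0)"
    by metis
  moreover have "eval F infinity_pt = 0"
    using y4 eval_infinity_pt[OF hom] by simp
  ultimately obtain i where i: "eval (pd i F) infinity_pt \<noteq> 0"
    using \<open>nonsingular F\<close> unfolding nonsingular_def by blast
  have minus: "mon a b c - Poly_Mapping.single cx 1 = mon (a - 1) b c"
    "mon a b c - Poly_Mapping.single cy 1 = mon a (b - 1) c"
    "mon a b c - Poly_Mapping.single cz 1 = mon a b (c - 1)" for a b c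
    by (rule poly_mapping_eqI, case_tac k, simp_all add: lookup_minus lookup_single)+
  have "of_nat (Poly_Mapping.lookup m i) * Poly_Mapping.lookup F m *
      mon_eval infinity_pt (m - Poly_Mapping.single i 1) = 0" if "m \<in> Poly_Mapping.keys F" for m
  proof (cases m rule: mon_cases)
    case (1 a b c)
    have "a + b + c = 4"
      using hom that 1 by (auto simp: homogeneous_iff)
    \<comment> \<open>In the first three cases the coefficient of F is zero; in the others a factor
      x or z survives any single differentiation and vanishes at infinity.\<close>
    then consider "a = 0" "c = 0" "b = 4" | "a = 1" "c = 0" "b = 3" | "a = 0" "c = 1" "b = 3"
      | "a \<ge> 2" | "c \<ge> 2" | "a = 1" "c = 1"
      by linarith
    then show ?thesis
      by cases (cases i; force simp: 1 minus[simplified] power_0_left y4 xy3[simplified] y3z[simplified])+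
  qed
  then have "eval (pd i F) infinity_pt = 0"
    unfolding pd_def eval_sum eval_single by (intro sum.neutral) auto
  with i show False
    by simp
qed

section \<open>Pluecker coordinates\<close>

lemma homogeneous_single: "mon_deg m = d \<Longrightarrow> homogeneous d (Poly_Mapping.single m c)"
  by (simp add: homogeneous_iff)

text \<open>At \<open>x^2\<close> and \<open>xy\<close> the coefficients of A and B form minus the
  identity matrix, so A and B are independent; both lack \<open>y^2\<close>, so they pass through
  infinity.\<close>

lemma spanning_conics: "spanning_pair (conicA c) (conicB c)"
proof -
  have "homogeneous 2 (conicA c)" "homogeneous 2 (conicB c)"
    unfolding conicA_eq conicB_eq by (intro homogeneous_add homogeneous_single; simp)+
  moreover from this have "eval (conicA c) infinity_pt = 0" "eval (conicB c) infinity_pt = 0"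
    by (simp_all add: eval_infinity_pt, simp_all add: conicA_eq conicB_eq lookup_add lookup_single)
  moreover have "l = 0 \<and> m = 0" if "const l * conicA c + const m * conicB c = 0" for l m
  proof -
    have "l * Poly_Mapping.lookup (conicA c) n + m * Poly_Mapping.lookup (conicB c) n = 0" for n
      using arg_cong[OF that, of "\<lambda>p. Poly_Mapping.lookup p n"] by (simp only: lookup_pencil lookup_zero)
    from this[of "mon 2 0 0"] this[of "mon 1 1 0"] show ?thesis
      by (simp add: conicA_eq conicB_eq lookup_add lookup_single)
  qed
  ultimately show ?thesis
    by (simp add: spanning_pair_def conics_through_infinity_def)
qed

section \<open>Change of basis in a pencil\<close>

lemma pencil_subset:
  assumes "A' = const l * A + const m * B" "B' = const l' * A + const m' * B"
  shows "pencil A' B' \<subseteq> pencil A B"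
proof -
  have "const r * A' + const s * B' =
      const (r * l + s * l') * A + const (r * m + s * m') * B" for r s
    unfolding assms
    by (rule poly_mapping_eqI) (simp only: lookup_add lookup_const_mult, simp add: algebra_simps)
  then show ?thesis
    unfolding pencil_def by blast
qed

lemma pencil_basis_change:
  assumes "A' = const l * A + const m * B" "B' = const l' * A + const m' * B"
    and det: "l * m' - m * l' \<noteq> 0"
  shows "pencil A' B' = pencil A B"
proof
  let ?d = "l * m' - m * l'"
  have "A = const (m' / ?d) * A' + const (- m / ?d) * B'"
    "B = const (- l' / ?d) * A' + const (l / ?d) * B'"
    unfolding assms(1,2)
    by (rule poly_mapping_eqI, simp only: lookup_add lookup_const_mult, use det in
        \<open>simp add: divide_simps, simp add: algebra_simps\<close>)+
  then show "pencil A B \<subseteq> pencil A' B'"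
    by (rule pencil_subset)
  show "pencil A' B' \<subseteq> pencil A B"
    using assms(1,2) by (rule pencil_subset)
qed

lemma pencil_generators: "A \<in> pencil A B" "B \<in> pencil A B"
proof -
  have "A = const 1 * A + const 0 * B" "B = const 0 * A + const 1 * B"
    by (simp_all add: const_def)
  then show "A \<in> pencil A B" "B \<in> pencil A B"
    unfolding pencil_def by blast+
qed

text \<open>Pluecker coordinates are 2x2 minors of the coefficients, so a base change multiplies all
  of them by its determinant.\<close>

lemma pluecker_basis_change:
  assumes "spanning_pair A' B'" "pencil A' B' = pencil A B"
  obtains k where "k \<noteq> 0" "pluecker A' B' = (\<lambda>i. k * pluecker A B i)"
proof -
  have "A' \<in> pencil A B" "B' \<in> pencil A B"
    using assms(2) pencil_generators by blast+
  then obtain l m l' m' where eqs: "A' = const l * A + const m * B" "B' = const l' * A + const m' * B"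
    unfolding pencil_def by blast
  have indep: "r = 0 \<and> s = 0" if "const r * A' + const s * B' = 0" for r s
    using assms(1) that unfolding spanning_pair_def by blast
  have "l * m' - m * l' \<noteq> 0"
  proof
    \<comment> \<open>Eliminating A and B in turn yields two relations between A' and B' whose
      coefficients are, up to sign, the entries of the base change. Independence makes all entries
      0, which forces A' = 0.\<close>
    assume d: "l * m' - m * l' = 0"
    have "const l' * A' + const (- l) * B' = 0" "const m' * A' + const (- m) * B' = 0"
      unfolding eqs
      by (rule poly_mapping_eqI, simp only: lookup_add lookup_const_mult lookup_zero,
          use d in algebra)+
    from indep[OF this(1)] indep[OF this(2)] have "A' = 0"
      unfolding eqs by (simp add: const_def)
    then have "const 1 * A' + const 0 * B' = 0"
      by (simp add: const_def)
    from indep[OF this] show False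
      by simp
  qed
  moreover have "pluecker A' B' = (\<lambda>i. (l * m' - m * l') * pluecker A B i)"
    unfolding eqs pluecker_def lookup_add lookup_const_mult
    by (rule ext) (auto simp: algebra_simps)
  ultimately show ?thesis
    by (rule that)
qed

lemma pluecker_coordsE:
  assumes "L \<in> lines_PV"
  obtains A B where "spanning_pair A B" "L = pencil A B" "pluecker_coords L = pluecker A B"
proof -
  have "\<exists>w A B. spanning_pair A B \<and> L = pencil A B \<and> w = pluecker A B"
    using assms by (auto simp: lines_PV_def)
  then have "\<exists>A B. spanning_pair A B \<and> L = pencil A B \<and> pluecker_coords L = pluecker A B"
    unfolding pluecker_coords_def by (rule someI_ex)
  then show ?thesis
    using that by blast
qed

text \<open>The basis behind \<open>pluecker_coords\<close> is unspecified, so its coordinates are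
  tied to those of a given basis only up to a nonzero factor.\<close>

lemma pluecker_coords_pencil:
  assumes "spanning_pair A B"
  obtains k where "k \<noteq> 0" "pluecker_coords (pencil A B) = (\<lambda>i. k * pluecker A B i)"
proof -
  have "pencil A B \<in> lines_PV"
    using assms by (auto simp: lines_PV_def)
  then obtain A' B' where *: "spanning_pair A' B'" "pencil A B = pencil A' B'"
    "pluecker_coords (pencil A B) = pluecker A' B'"
    by (rule pluecker_coordsE)
  obtain k where "k \<noteq> 0" "pluecker A' B' = (\<lambda>i. k * pluecker A B i)"
    using *(1) *(2)[symmetric] by (rule pluecker_basis_change)
  with *(3) show ?thesis
    by (intro that) auto
qed

text \<open>The coefficients of the basis \<open>A, B\<close> of the pencil that is normalised at \<open>x\<^sup>2\<close> and \<open>xy\<close>,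
  by Cramer's rule; junk if the minor of these two monomials vanishes.\<close>

definition pencil_chart :: "((crd \<Rightarrow>\<^sub>0 nat) \<times> (crd \<Rightarrow>\<^sub>0 nat) \<Rightarrow> complex) \<Rightarrow> coef \<Rightarrow> complex" where
  "pencil_chart w = (let d = w (mon 2 0 0, mon 1 1 0) in (\<lambda>_. 0)
     (a00 := - (w (mon 0 0 2, mon 1 1 0) / d),
      a10 := - (w (mon 1 0 1, mon 1 1 0) / d),
      a01 := - (w (mon 0 1 1, mon 1 1 0) / d),
      b00 := - (w (mon 2 0 0, mon 0 0 2) / d),
      b10 := - (w (mon 2 0 0, mon 1 0 1) / d),
      b01 := - (w (mon 2 0 0, mon 0 1 1) / d)))"

lemma pencil_chart_scale: "k \<noteq> 0 \<Longrightarrow> pencil_chart (\<lambda>i. k * w i) = pencil_chart w"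
  by (simp add: pencil_chart_def Let_def)

text \<open>Here the minor at (\<open>x^2\<close>, \<open>xy\<close>) is 1, while for m among
  \<open>z^2\<close>, \<open>xz\<close>, \<open>yz\<close> the minors at (m, \<open>xy\<close>) and
  (\<open>x^2\<close>, m) are minus the coefficients of A and B at m; hence the signs in
  \<open>pencil_chart\<close>.\<close>

lemma pencil_chart_conics:
  "i \<in> {a00, a10, a01, b00, b10, b01} \<Longrightarrow> pencil_chart (pluecker (conicA c) (conicB c)) i = c i"
  by (auto simp: pencil_chart_def pluecker_def conicA_eq conicB_eq lookup_add lookup_single)

text \<open>The only further quadratic monomial is \<open>y^2\<close>, and its coefficient is the
  value at infinity, hence 0.\<close>

lemma conic_through_infinity_eqI:
  assumes "A \<in> conics_through_infinity" "B \<in> conics_through_infinity"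
    and "\<And>m. m \<in> {mon 2 0 0, mon 1 1 0, mon 0 0 2, mon 1 0 1, mon 0 1 1} \<Longrightarrow>
      Poly_Mapping.lookup A m = Poly_Mapping.lookup B m"
  shows "A = B"
proof (rule poly_mapping_eqI)
  fix m :: "crd \<Rightarrow>\<^sub>0 nat"
  obtain i j k where m: "m = mon i j k"
    by (rule mon_cases)
  have hom: "homogeneous 2 A" "homogeneous 2 B"
    using assms(1,2) by (auto simp: conics_through_infinity_def)
  have y2: "Poly_Mapping.lookup A (mon 0 2 0) = 0" "Poly_Mapping.lookup B (mon 0 2 0) = 0"
    using assms(1,2) hom by (auto simp: conics_through_infinity_def eval_infinity_pt)
  show "Poly_Mapping.lookup A m = Poly_Mapping.lookup B m"
  proof (cases "i + j + k = 2")
    case True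
    then have "m \<in> {mon 2 0 0, mon 1 1 0, mon 0 0 2, mon 1 0 1, mon 0 1 1, mon 0 2 0}"
      unfolding m by auto
    then show ?thesis
      using assms(3)[of m] y2 by auto
  next
    case False
    then have "m \<notin> Poly_Mapping.keys A" "m \<notin> Poly_Mapping.keys B"
      using hom unfolding m homogeneous_iff by (metis mon_deg_mon)+
    then show ?thesis
      by (simp add: in_keys_iff)
  qed
qed

lemma pencil_conics_through_infinity:
  assumes "A \<in> conics_through_infinity" "B \<in> conics_through_infinity"
  shows "const l * A + const m * B \<in> conics_through_infinity"
  using assms homogeneous_mult[OF homogeneous_const, where e = 2, unfolded add_0]
  by (auto simp: conics_through_infinity_def intro!: homogeneous_add)

text \<open>A nonzero minor at (\<open>x^2\<close>, \<open>xy\<close>) permits a base change that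
  turns the coefficient matrix at these monomials into minus the identity, which is the shape of
  \<open>conicA\<close> and \<open>conicB\<close>.\<close>

lemma pencil_pencil_chart:
  assumes "L \<in> lines_PV" and d: "pluecker_coords L (mon 2 0 0, mon 1 1 0) \<noteq> 0"
  defines "c \<equiv> pencil_chart (pluecker_coords L)"
  shows "L = pencil (conicA c) (conicB c)"
proof -
  obtain A B where AB: "spanning_pair A B" "L = pencil A B" and w: "pluecker_coords L = pluecker A B"
    using assms(1) by (rule pluecker_coordsE)
  let ?d = "pluecker A B (mon 2 0 0, mon 1 1 0)"
  let ?A = "Poly_Mapping.lookup A" and ?B = "Poly_Mapping.lookup B"
  have "?d \<noteq> 0"
    using d w by simp
  have V: "A \<in> conics_through_infinity" "B \<in> conics_through_infinity"
    "conicA c \<in> conics_through_infinity" "conicB c \<in> conics_through_infinity"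
    using AB(1) spanning_conics[of c] by (auto simp: spanning_pair_def)
  \<comment> \<open>The weights solve the 2x2 system asking for coefficient -1 at \<open>x^2\<close>
    and 0 at \<open>xy\<close>; for the second conic the two roles are exchanged.\<close>
  have "conicA c = const (- ?B (mon 1 1 0) / ?d) * A + const (?A (mon 1 1 0) / ?d) * B"
    by (rule conic_through_infinity_eqI[OF V(3) pencil_conics_through_infinity[OF V(1,2)]])
      (simp only: lookup_pencil, use \<open>?d \<noteq> 0\<close> in \<open>auto simp: c_def w pencil_chart_def Let_def
        conicA_eq lookup_add lookup_single pluecker_def divide_simps; simp add: algebra_simps\<close>)
  moreover have "conicB c = const (?B (mon 2 0 0) / ?d) * A + const (- ?A (mon 2 0 0) / ?d) * B"
    by (rule conic_through_infinity_eqI[OF V(4) pencil_conics_through_infinity[OF V(1,2)]])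
      (simp only: lookup_pencil, use \<open>?d \<noteq> 0\<close> in \<open>auto simp: c_def w pencil_chart_def Let_def
        conicB_eq lookup_add lookup_single pluecker_def divide_simps; simp add: algebra_simps\<close>)
  moreover have "- ?B (mon 1 1 0) / ?d * (- ?A (mon 2 0 0) / ?d)
      - ?A (mon 1 1 0) / ?d * (?B (mon 2 0 0) / ?d) = 1 / ?d"
  proof -
    have "- ?B (mon 1 1 0) / ?d * (- ?A (mon 2 0 0) / ?d)
        - ?A (mon 1 1 0) / ?d * (?B (mon 2 0 0) / ?d)
        = (?A (mon 2 0 0) * ?B (mon 1 1 0) - ?A (mon 1 1 0) * ?B (mon 2 0 0)) / (?d * ?d)"
      by (simp add: diff_divide_distrib mult_ac)
    also have "\<dots> = ?d / (?d * ?d)"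
      by (simp add: pluecker_def)
    finally show ?thesis
      by simp
  qed
  ultimately show ?thesis
    using \<open>?d \<noteq> 0\<close> AB(2) pencil_basis_change by (metis divide_eq_0_iff zero_neq_one)
qed

section \<open>Solving for the cofactors\<close>

text \<open>Among the coefficient equations of \<open>F = AG + BH\<close>, those of
  \<open>x\<^sup>4, x\<^sup>3y, xy\<^sup>3, y\<^sup>3z, x\<^sup>2y\<^sup>2, x\<^sup>3z, xy\<^sup>2z, y\<^sup>2z\<^sup>2, x\<^sup>2yz, x\<^sup>2z\<^sup>2, xyz\<^sup>2\<close>, in this order,
  are triangular in the coefficients of \<open>G\<close> and \<open>H\<close>, with all pivots \<open>\<plusminus>1\<close> or \<open>a01\<close>.\<close>

definition solve_cofactors :: "crd mpol \<Rightarrow> (coef \<Rightarrow> complex) \<Rightarrow> coef \<Rightarrow> complex" where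
  "solve_cofactors F c = (let
     f = (\<lambda>i j k. Poly_Mapping.lookup F (mon i j k));
     G20 = - f 4 0 0;
     H20 = - 1 - f 3 1 0;
     H02 = - f 1 3 0;
     G02 = (f 0 3 1 - c b01 * H02) / c a01;
     H11 = - f 2 2 0 - G02;
     G10 = c a10 * G20 + c b10 * H20 - f 3 0 1;
     H01 = c a10 * G02 + c a01 + c b10 * H02 + c b01 * H11 - f 1 2 1;
     G01 = (f 0 2 2 - c a00 * G02 - c b01 * H01 - c b00 * H02) / c a01;
     H10 = - G01 + c a10 + c a01 * G20 + c b10 * H11 + c b01 * H20 - f 2 1 1;
     G00 = c a10 * G10 + c a00 * G20 + c b10 * H10 + c b00 * H20 - f 2 0 2;
     H00 = c a10 * G01 + c a01 * G10 + c a00 + c b10 * H01 + c b01 * H10 + c b00 * H11 - f 1 1 2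
   in c(g00 := G00, g10 := G10, g01 := G01, g20 := G20, g02 := G02,
        h00 := H00, h10 := H10, h01 := H01, h20 := H20, h11 := H11, h02 := H02))"

lemma solve_cofactors_conics [simp]:
  "conicA (solve_cofactors F c) = conicA c" "conicB (solve_cofactors F c) = conicB c"
  by (simp_all add: conicA_def conicB_def solve_cofactors_def Let_def)

text \<open>Inserting the coefficients of a genuine decomposition makes each solved equation
  collapse to the original entry. Agreement on the entries of A and B suffices, since all others are
  overwritten.\<close>

lemma solve_cofactors_unique:
  assumes F: "F = decomposition_form c" and "c a01 \<noteq> 0"
    and eq: "\<And>i. i \<in> {a00, a10, a01, b00, b10, b01} \<Longrightarrow> c' i = c i"
  shows "solve_cofactors F c' = c"
proof
  fix i
  have "c' a00 = c a00" "c' a10 = c a10" "c' a01 = c a01"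
    "c' b00 = c b00" "c' b10 = c b10" "c' b01 = c b01"
    by (simp_all add: eq)
  then show "solve_cofactors F c' i = c i"
    unfolding solve_cofactors_def F decomposition_form_coeffs Let_def using \<open>c a01 \<noteq> 0\<close>
    by (cases i) simp_all
qed

text \<open>The only divisions in the solution are by \<open>a01\<close>.\<close>

lemma solve_cofactors_homogeneous_fractions:
  assumes c: "\<And>i. (\<lambda>s. c s i) \<in> homogeneous_fractions h T"
    and nonzero: "\<And>s. s \<in> T \<Longrightarrow> c s a01 \<noteq> 0"
  shows "(\<lambda>s. solve_cofactors F (c s) i) \<in> homogeneous_fractions h T"
  unfolding solve_cofactors_def Let_def
  by (cases i; simp;
      intro fa_intros[OF function_algebra_homogeneous_fractions] homogeneous_fractions_divide c nonzero)

lemma pencil_chart_homogeneous_fractions: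
  assumes "\<And>s. s \<in> T \<Longrightarrow> h s (mon 2 0 0, mon 1 1 0) \<noteq> 0"
  shows "(\<lambda>s. pencil_chart (h s) i) \<in> homogeneous_fractions h T"
proof -
  note alg = function_algebra_homogeneous_fractions[of h T]
  have "(\<lambda>s. - (h s j / h s (mon 2 0 0, mon 1 1 0))) \<in> homogeneous_fractions h T" for j
    using assms by (intro fa_minus[OF alg] coordinate_quotient)
  then show ?thesis
    using fa_const[OF alg, of 0] by (cases i) (simp_all add: pencil_chart_def Let_def)
qed

section \<open>The embedding\<close>

abbreviation "pencil_map c \<equiv> pencil (conicA c) (conicB c)"

abbreviation polynomial_fractions ::
  "((('v \<Rightarrow> complex) \<Rightarrow> complex) \<times> (('v \<Rightarrow> complex) \<Rightarrow> complex)) set" where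
  "polynomial_fractions \<equiv> {(eval p, eval q) | p q. True}"

abbreviation homogeneous_pairs ::
  "('a \<Rightarrow> 'v \<Rightarrow> complex) \<Rightarrow> (('a \<Rightarrow> complex) \<times> ('a \<Rightarrow> complex)) set" where
  "homogeneous_pairs h \<equiv>
     {(\<lambda>s. eval p (h s), \<lambda>s. eval q (h s)) | p q. \<exists>d. homogeneous d p \<and> homogeneous d q}"

lemma one_polynomial_fraction: "(\<lambda>_. 1, \<lambda>_. 1) \<in> polynomial_fractions"
proof -
  have "(\<lambda>_. 1) = eval (const 1)"
    by auto
  then show ?thesis
    by blast
qed

lemma one_homogeneous_pair:
  fixes h :: "'a \<Rightarrow> 'v \<Rightarrow> complex"
  shows "(\<lambda>_. 1, \<lambda>_. 1) \<in> homogeneous_pairs h"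
proof -
  have "(\<lambda>_. 1) = (\<lambda>s. eval (const 1 :: 'v mpol) (h s))"
    by auto
  then show ?thesis
    using homogeneous_const by blast
qed

text \<open>The minors of (A, B) are polynomials in the parameters. A free target \<open>T\<close>
  covers both the whole Grassmannian and the image.\<close>

lemma morphism_pencil_map:
  assumes "pencil_map ` S \<subseteq> T"
  shows "morphism (affine_variety S) (fraction_space T (homogeneous_pairs pluecker_coords)) pencil_map"
  unfolding affine_variety_def
proof (rule morphism_fraction_space[OF one_polynomial_fraction one_homogeneous_pair assms])
  fix p q :: "crd mpol set \<Rightarrow> complex"
  assume "(p, q) \<in> homogeneous_pairs pluecker_coords"
  then obtain P Q d where hom: "homogeneous d P" "homogeneous d Q"
    and pq: "p = (\<lambda>L. eval P (pluecker_coords L))" "q = (\<lambda>L. eval Q (pluecker_coords L))"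
    by auto
  let ?w = "\<lambda>c. pluecker (conicA c) (conicB c)"
  have "(\<lambda>c. ?w c i) \<in> range eval" for i
    unfolding pluecker_def conicA_eq conicB_eq lookup_add lookup_single case_prod_unfold
    by (intro fa_intros[OF function_algebra_polynomials] coordinate_polynomial)
  then have "(\<lambda>c. eval R (?w c)) \<in> range eval" for R
    by (rule fa_eval[OF function_algebra_polynomials])
  then obtain P' Q' where P'Q': "(\<lambda>c. eval P (?w c)) = eval P'" "(\<lambda>c. eval Q (?w c)) = eval Q'"
    by (meson rangeE)
  \<comment> \<open>Both forms have degree \<open>d\<close>, so the unknown factor enters each value
    as \<open>k ^ d\<close> and cancels.\<close>
  have "(eval Q' c \<noteq> 0 \<longleftrightarrow> q (pencil_map c) \<noteq> 0) \<and>
      eval P' c / eval Q' c = p (pencil_map c) / q (pencil_map c)" for c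
  proof -
    obtain k where "k \<noteq> 0" "pluecker_coords (pencil_map c) = (\<lambda>i. k * ?w c i)"
      using spanning_conics by (rule pluecker_coords_pencil)
    then show ?thesis
      using fun_cong[OF P'Q'(1), of c] fun_cong[OF P'Q'(2), of c]
      by (simp add: pq eval_scale[OF hom(1)] eval_scale[OF hom(2)])
  qed
  moreover have "(eval P', eval Q') \<in> polynomial_fractions"
    by blast
  ultimately show "\<exists>p' q'. (p', q') \<in> polynomial_fractions \<and>
      (\<forall>c\<in>S. (q' c \<noteq> 0 \<longleftrightarrow> q (pencil_map c) \<noteq> 0) \<and>
        (q (pencil_map c) \<noteq> 0 \<longrightarrow> p' c / q' c = p (pencil_map c) / q (pencil_map c)))"
    by blast
qed

lemma morphism_homogeneous_fractions:
  fixes \<psi> :: "'a \<Rightarrow> 'v \<Rightarrow> complex"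
  assumes "\<psi> ` T \<subseteq> S" and "\<And>i. (\<lambda>s. \<psi> s i) \<in> homogeneous_fractions h T"
  shows "morphism (fraction_space T (homogeneous_pairs h)) (affine_variety S) \<psi>"
  unfolding affine_variety_def
proof (rule morphism_fraction_space[OF one_homogeneous_pair one_polynomial_fraction assms(1)])
  fix p q :: "('v \<Rightarrow> complex) \<Rightarrow> complex"
  assume "(p, q) \<in> polynomial_fractions"
  then obtain P Q where pq: "p = eval P" "q = eval Q"
    by auto
  have frac: "(\<lambda>s. eval R (\<psi> s)) \<in> homogeneous_fractions h T" for R
    using assms(2) by (rule fa_eval[OF function_algebra_homogeneous_fractions])
  obtain d P1 Q1 where 1: "homogeneous d P1" "homogeneous d Q1"
    "\<And>s. s \<in> T \<Longrightarrow> eval Q1 (h s) \<noteq> 0 \<and> eval P (\<psi> s) = eval P1 (h s) / eval Q1 (h s)"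
    using frac[of P] unfolding homogeneous_fractions_def by blast
  obtain e P2 Q2 where 2: "homogeneous e P2" "homogeneous e Q2"
    "\<And>s. s \<in> T \<Longrightarrow> eval Q2 (h s) \<noteq> 0 \<and> eval Q (\<psi> s) = eval P2 (h s) / eval Q2 (h s)"
    using frac[of Q] unfolding homogeneous_fractions_def by blast
  \<comment> \<open>The double fraction (P1/Q1)/(P2/Q2) is cleared to (P1 Q2)/(Q1 P2). As Q1 and Q2
    have no zero on \<open>T\<close>, the new denominator vanishes exactly where Q composed with
    \<open>\<psi>\<close> does.\<close>
  have "homogeneous (d + e) (P1 * Q2)" "homogeneous (d + e) (Q1 * P2)"
    using 1 2 by (auto intro: homogeneous_mult)
  then have "(\<lambda>s. eval (P1 * Q2) (h s), \<lambda>s. eval (Q1 * P2) (h s)) \<in> homogeneous_pairs h"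
    by blast
  moreover have "\<forall>s\<in>T. (eval (Q1 * P2) (h s) \<noteq> 0 \<longleftrightarrow> q (\<psi> s) \<noteq> 0) \<and>
      eval (P1 * Q2) (h s) / eval (Q1 * P2) (h s) = p (\<psi> s) / q (\<psi> s)"
    using 1(3) 2(3) by (simp add: pq)
  ultimately show "\<exists>p' q'. (p', q') \<in> homogeneous_pairs h \<and> (\<forall>s\<in>T. (q' s \<noteq> 0 \<longleftrightarrow> q (\<psi> s) \<noteq> 0) \<and>
      (q (\<psi> s) \<noteq> 0 \<longrightarrow> p' s / q' s = p (\<psi> s) / q (\<psi> s)))"
    by blast
qed

text \<open>On \<open>U\<close> the fraction vanishes exactly where its numerator does, and the zero
  locus of the numerator is closed in all of \<open>S\<close>.\<close>

lemma closedin_zero_locus: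
  assumes "f \<in> homogeneous_fractions h U" "U \<subseteq> S"
  obtains C where "closedin (zariski (projective_variety h S)) C" "{s \<in> U. f s = 0} = U \<inter> C"
proof -
  obtain d p q where pq: "homogeneous d p"
    "\<And>s. s \<in> U \<Longrightarrow> eval q (h s) \<noteq> 0 \<and> f s = eval p (h s) / eval q (h s)"
    using assms(1) unfolding homogeneous_fractions_def by blast
  let ?Y = "fraction_space S (homogeneous_pairs h)"
  have "openin (zariski ?Y) {s \<in> S. eval p (h s) \<noteq> 0}"
    using pq(1) by (intro openin_nonzero) blast
  moreover have "S - {s \<in> S. eval p (h s) = 0} = {s \<in> S. eval p (h s) \<noteq> 0}"
    by auto
  ultimately have "closedin (zariski (projective_variety h S)) {s \<in> S. eval p (h s) = 0}"
    unfolding projective_variety_def closedin_def points_fraction_space[OF one_homogeneous_pair]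
    by auto
  moreover have "{s \<in> U. f s = 0} = U \<inter> {s \<in> S. eval p (h s) = 0}"
    using pq(2) assms(2) by auto
  ultimately show ?thesis
    by (rule that)
qed

theorem mainTheorem6:
  fixes F :: "crd mpol"
  assumes "homogeneous 4 F"
    and "nonsingular F"
    and "cuts_four_infinity F"
  shows "morphism (Z_variety F) grassmannian_PV (\<lambda>c. pencil (conicA c) (conicB c))
    \<and> inj_on (\<lambda>c. pencil (conicA c) (conicB c)) (Z_set F)
    \<and> embedding (Z_variety F) grassmannian_PV (\<lambda>c. pencil (conicA c) (conicB c))"
proof -

  \<comment> \<open>The inverse on an open chart\<close>
  let ?Z = "Z_set F" and ?w = pluecker_coords
  let ?R = "homogeneous_pairs ?w"
  define T where "T = pencil_map ` ?Z"
  \<comment> \<open>The first condition lets the pencil be normalised; the second then says that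
    \<open>a01\<close> of the normalised basis is nonzero, which is what solving for G and H
    requires.\<close>
  define U where "U = {L \<in> lines_PV. ?w L (mon 2 0 0, mon 1 1 0) \<noteq> 0 \<and> ?w L (mon 0 1 1, mon 1 1 0) \<noteq> 0}"
  define \<psi> where "\<psi> L = solve_cofactors F (pencil_chart (?w L))" for L
  have gr: "grassmannian_PV = fraction_space lines_PV ?R"
    by (simp add: grassmannian_PV_def projective_variety_def)
  have lines: "pencil_map c \<in> lines_PV" for c
    using spanning_conics by (auto simp: lines_PV_def)
  have decomp: "F = decomposition_form c" if "c \<in> ?Z" for c
    using that by (simp add: Z_set_def)
  have a01: "c a01 \<noteq> 0" if "c \<in> ?Z" for c
  proof -
    have "Poly_Mapping.lookup F (mon 0 4 0) = 0"
      unfolding decomp[OF that] by (rule decomposition_form_coeffs)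
    moreover have xy3: "Poly_Mapping.lookup F (mon 1 3 0) = 0"
      using assms(1,3) by (rule hyperflex_coeff_xy3)
    ultimately have "Poly_Mapping.lookup F (mon 0 3 1) \<noteq> 0"
      using nonsingular_coeff_y3z assms(1,2) by blast
    \<comment> \<open>The coefficient of \<open>xy^3\<close> is \<open>- c h02\<close>, so
      \<open>c h02\<close> is 0 and the coefficient of \<open>y^3z\<close> reduces to
      \<open>c a01 * c g02\<close>.\<close>
    with xy3 show ?thesis
      unfolding decomp[OF that] decomposition_form_coeffs by auto
  qed
  have chart: "pencil_chart (?w (pencil_map c)) i = c i"
    if "i \<in> {a00, a10, a01, b00, b10, b01}" for c i
  proof -
    obtain k where "k \<noteq> 0" "?w (pencil_map c) = (\<lambda>i. k * pluecker (conicA c) (conicB c) i)"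
      using spanning_conics by (rule pluecker_coords_pencil)
    then show ?thesis
      using pencil_chart_scale pencil_chart_conics[OF that] by simp
  qed
  have left_inv: "\<psi> (pencil_map c) = c" if "c \<in> ?Z" for c
    unfolding \<psi>_def using decomp[OF that] a01[OF that] chart by (rule solve_cofactors_unique)
  have inU: "pencil_map c \<in> U" if "c \<in> ?Z" for c
  proof -
    obtain k where "k \<noteq> 0" "?w (pencil_map c) = (\<lambda>i. k * pluecker (conicA c) (conicB c) i)"
      using spanning_conics by (rule pluecker_coords_pencil)
    then show ?thesis
      using lines a01[OF that]
      by (simp add: U_def pluecker_def conicA_eq conicB_eq lookup_add lookup_single)
  qed
  have pencil_\<psi>: "pencil_map (\<psi> L) = L" if "L \<in> U" for L
    using that pencil_pencil_chart[of L] by (simp add: U_def \<psi>_def)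
  \<comment> \<open>Each \<open>L\<close> in \<open>U\<close> is the pencil of
    \<open>\<psi> L\<close>, so it lies in the image as soon as \<open>\<psi> L\<close> is a point
    of Z; the converse is \<open>left_inv\<close>.\<close>
  have T_eq: "T = {L \<in> U. \<psi> L \<in> ?Z}"
    using inU left_inv pencil_\<psi> by (force simp: T_def)
  have "T \<subseteq> U" "U \<subseteq> lines_PV"
    by (auto simp: T_eq U_def)
  have chart_frac: "(\<lambda>L. pencil_chart (?w L) i) \<in> homogeneous_fractions ?w U" for i
    by (rule pencil_chart_homogeneous_fractions) (auto simp: U_def)
  have \<psi>_frac: "(\<lambda>L. \<psi> L i) \<in> homogeneous_fractions ?w U" for i
    unfolding \<psi>_def
    by (rule solve_cofactors_homogeneous_fractions[OF chart_frac])
      (auto simp: U_def pencil_chart_def Let_def)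

  have mor: "morphism (Z_variety F) grassmannian_PV pencil_map"
    unfolding Z_variety_def gr by (rule morphism_pencil_map) (use lines in auto)
  have inj: "inj_on pencil_map ?Z"
    by (rule inj_on_inverseI[of _ \<psi>]) (rule left_inv)
  have ptsZ: "points (Z_variety F) = ?Z"
    unfolding Z_variety_def affine_variety_def by (rule points_fraction_space[OF one_polynomial_fraction])

  \<comment> \<open>The image is locally closed\<close>
  have "locally_closed grassmannian_PV T"
  proof -
    \<comment> \<open>\<open>?E m\<close> is the error at the exponent \<open>m\<close> in the
      candidate decomposition of F obtained from \<open>L\<close>.\<close>
    let ?E = "\<lambda>m L. Poly_Mapping.lookup (decomposition_form (\<psi> L)) m - Poly_Mapping.lookup F m"
    have E: "?E m \<in> homogeneous_fractions ?w U" for m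
      by (intro fa_intros[OF function_algebra_homogeneous_fractions] \<psi>_frac
          fa_lookup_decomposition_form[OF function_algebra_homogeneous_fractions])
    have "\<forall>m. \<exists>C. closedin (zariski grassmannian_PV) C \<and> {L \<in> U. ?E m L = 0} = U \<inter> C"
    proof
      fix m
      obtain C where "closedin (zariski grassmannian_PV) C" "{L \<in> U. ?E m L = 0} = U \<inter> C"
        unfolding grassmannian_PV_def using E \<open>U \<subseteq> lines_PV\<close> by (rule closedin_zero_locus)
      then show "\<exists>C. closedin (zariski grassmannian_PV) C \<and> {L \<in> U. ?E m L = 0} = U \<inter> C"
        by (intro exI conjI)
    qed
    \<comment> \<open>One closed set is chosen for each of the infinitely many exponents; their
      intersection is still closed.\<close>
    then obtain C where C: "\<forall>m. closedin (zariski grassmannian_PV) (C m) \<and>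
        {L \<in> U. ?E m L = 0} = U \<inter> C m"
      by (rule choice[THEN exE])
    have "\<psi> L \<in> ?Z \<longleftrightarrow> (\<forall>m. ?E m L = 0)" for L
      by (auto simp: Z_set_def poly_mapping_eq_iff fun_eq_iff)
    then have "T = (\<Inter>m. {L \<in> U. ?E m L = 0})"
      by (auto simp: T_eq)
    then have "T = U \<inter> (\<Inter>m. C m)"
      using C by simp
    moreover have "closedin (zariski grassmannian_PV) (\<Inter>m. C m)"
      using C by (intro closedin_Inter) auto
    moreover have "openin (zariski grassmannian_PV) U"
    proof -
      have nonzero: "openin (zariski grassmannian_PV) {L \<in> lines_PV. ?w L i \<noteq> 0}" for i
      proof -
        have "(\<lambda>L. eval (var i) (?w L), \<lambda>L. eval (var i) (?w L)) \<in> ?R"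
          using homogeneous_var[of i] by blast
        from openin_nonzero[OF this, of lines_PV] show ?thesis
          by (simp add: gr)
      qed
      have U_eq: "U = {L \<in> lines_PV. ?w L (mon 2 0 0, mon 1 1 0) \<noteq> 0} \<inter>
          {L \<in> lines_PV. ?w L (mon 0 1 1, mon 1 1 0) \<noteq> 0}"
        by (auto simp: U_def)
      show ?thesis
        unfolding U_eq by (intro openin_Int nonzero)
    qed
    ultimately show ?thesis
      unfolding locally_closed_def by blast
  qed

  \<comment> \<open>Isomorphism onto the image\<close>
  moreover have "isomorphism (Z_variety F) (subspace_fs grassmannian_PV T) pencil_map"
    unfolding isomorphism_def
  proof (intro conjI exI[of _ \<psi>] ballI)
    have sub: "T \<subseteq> lines_PV"
      using \<open>T \<subseteq> U\<close> \<open>U \<subseteq> lines_PV\<close> by simp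
    show "morphism (Z_variety F) (subspace_fs grassmannian_PV T) pencil_map"
      unfolding gr morphism_into_subspace[OF one_homogeneous_pair sub] Z_variety_def
      by (rule morphism_pencil_map) (simp add: T_def)
    have "(\<lambda>L. \<psi> L i) \<in> homogeneous_fractions ?w T" for i
      using \<psi>_frac[of i] \<open>T \<subseteq> U\<close> unfolding homogeneous_fractions_def by blast
    then show "morphism (subspace_fs grassmannian_PV T) (Z_variety F) \<psi>"
      unfolding gr morphism_from_subspace[OF one_homogeneous_pair sub] Z_variety_def
      by (intro morphism_homogeneous_fractions) (auto simp: T_eq)
    show "\<psi> (pencil_map c) = c" if "c \<in> points (Z_variety F)" for c
      using that left_inv by (simp add: ptsZ)
    show "pencil_map (\<psi> L) = L" if "L \<in> points (subspace_fs grassmannian_PV T)" for L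
      using that pencil_\<psi> \<open>T \<subseteq> U\<close> by (auto simp: subspace_fs_def)
  qed
  ultimately have "embedding (Z_variety F) grassmannian_PV pencil_map"
    using mor by (simp add: embedding_def ptsZ T_def)
  with mor inj show ?thesis
    by blast
qed

end
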